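(* For all integers $k\ge1$, $N\ge0$ and $j\ge0$, $$\mathsf C^{\mathrm{fwd}}_{k,N}(j)=\mathbf 1_{\{j=k+N\}}+(q-1)\sum_{r=0}^{N-1}\mathsf C^{\mathrm{bwd}}_{k+r-1,N-r-1}(j).$$ Equivalently, $$\mu^{\mathrm{fwd}}_{k,N}=q^{-N}\delta_{k+N}+(q-1)\sum_{r=0}^{N-1}q^{-r-1}\mu^{\mathrm{bwd}}_{k+r-1,N-r-1}.$$
   Context: Let $q$ be a prime power, $F=\mathbb F_q((t^{-1}))$, $\mathcal O=\mathbb F_q[[t^{-1}]]$, $\pi=t^{-1}$. $\mathcal T$ is the Bruhat--Tits tree of $\mathrm{PGL}_2(F)$: vertices are homothety classes $[L]$ of $\mathcal O$-lattices in $F^2$, adjacent if representatives can be chosen with $\pi L\subsetneq L'\subsetneq L$, $L/L'\simeq\mathbb F_q$; it is $(q+1)$-regular. Put $v_n=[\mathrm{diag}(t^n,1)]\cdot[\mathcal O^2]$. The quotient of $\mathcal T$ by $\mathrm{PGL}_2(\mathbb F_q[t])$ is a ray represented by $v_0-v_1-\cdots$, and the height $h(v)$ of a vertex is the $n\ge0$ for which $v$ lies in the orbit of $v_n$. All neighbors of a height-$0$ vertex have height $1$; a vertex of height $k\ge1$ has exactly one neighbor of height $k+1$ and exactly $q$ of height $k-1$. An oriented edge $e=(z_{-1},z_0)$ with $h(z_0)=k$ is forward (state $(\mathrm{fwd},k)$, $k\ge1$) if $h(z_{-1})=k-1$, backward (state $(\mathrm{bwd},k)$, $k\ge0$) if $h(z_{-1})=k+1$.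 $\mathrm{Desc}_N(e)$ is the set of terminal vertices $z_N$ of non-backtracking paths $z_{-1}\to z_0\to\cdots\to z_N$ ($q^N$ elements). $\mathsf C^{\varepsilon}_{k,N}(j)$ is the number of vertices of height $j$ in $\mathrm{Desc}_N(e)$ for $e$ in state $(\varepsilon,k)$; it depends only on the state. $\mu^{\varepsilon}_{k,N}(j)=q^{-N}\mathsf C^{\varepsilon}_{k,N}(j)$. $\delta_j$ is the Dirac mass at height $j$ and $\mathbf 1_E$ the indicator of a condition $E$. *)

theory Defs
  imports
    "HOL-Analysis.Analysis"
    "HOL-Computational_Algebra.Formal_Laurent_Series"
begin

text \<open>
  The finite field of order \<open>q\<close> is a type \<open>'k\<close> of class \<open>field\<close> and \<open>finite\<close>, with \<open>q = CARD('k)\<close>.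
  The field \<open>F\<close> of Laurent series in \<open>1/t\<close> is \<open>'k fls\<close>, whose formal variable \<open>fls_X\<close> is the
  uniformizer \<open>\<pi> = 1/t\<close>; hence \<open>t\<close> is \<open>fls_X_inv\<close>.
\<close>

definition int_ring :: "'k::field fls set" where
  "int_ring = range fps_to_fls"

definition poly_ring :: "'k::field fls set" where
  "poly_ring = range (\<lambda>p. poly (map_poly fls_const p) fls_X_inv)"

definition std_lattice :: "('k::field fls ^ 2) set" where
  "std_lattice = {x. \<forall>i. x $ i \<in> int_ring}"

text \<open>The columns of \<open>g\<close> below are an \<open>F\<close>-basis of \<open>F\<^sup>2\<close>, and \<open>L\<close> is its \<open>\<O>\<close>-span.\<close>

definition is_lattice :: "('k::field fls ^ 2) set \<Rightarrow> bool" where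
  "is_lattice L \<longleftrightarrow> (\<exists>g :: 'k fls ^ 2 ^ 2. invertible g \<and> L = (*v) g ` std_lattice)"

type_synonym 'k vertex = "('k fls ^ 2) set set"

definition homothety_class :: "('k::field fls ^ 2) set \<Rightarrow> 'k vertex" where
  "homothety_class L = {(*s) c ` L | c. c \<noteq> 0}"

text \<open>
  \<open>L/L' \<simeq> F\<^sub>q\<close> as \<open>\<O>\<close>-modules: there is an \<open>\<O>\<close>-linear surjection from \<open>L\<close> onto the residue
  field with kernel \<open>L'\<close>, where \<open>\<O>\<close> acts on the residue field through the constant coefficient.
\<close>

definition quotient_iso_residue_field ::
    "('k::field fls ^ 2) set \<Rightarrow> ('k fls ^ 2) set \<Rightarrow> bool" where
  "quotient_iso_residue_field L L' \<longleftrightarrow>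
     (\<exists>\<phi> :: 'k fls ^ 2 \<Rightarrow> 'k.
        (\<forall>x\<in>L. \<forall>y\<in>L. \<phi> (x + y) = \<phi> x + \<phi> y) \<and>
        (\<forall>a\<in>int_ring. \<forall>x\<in>L. \<phi> (a *s x) = fls_nth a 0 * \<phi> x) \<and>
        \<phi> ` L = UNIV \<and> {x \<in> L. \<phi> x = 0} = L')"

definition adjacent :: "'k::field vertex \<Rightarrow> 'k vertex \<Rightarrow> bool" where
  "adjacent v w \<longleftrightarrow>
     (\<exists>L L'. is_lattice L \<and> is_lattice L' \<and> v = homothety_class L \<and> w = homothety_class L' \<and>
             (*s) fls_X ` L \<subset> L' \<and> L' \<subset> L \<and> quotient_iso_residue_field L L')"

definition poly_GL2 :: "('k::field fls ^ 2 ^ 2) set" where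
  "poly_GL2 = {g. (\<forall>i j. g $ i $ j \<in> poly_ring) \<and>
                  (\<exists>h. (\<forall>i j. h $ i $ j \<in> poly_ring) \<and> g ** h = mat 1 \<and> h ** g = mat 1)}"

definition act :: "'k::field fls ^ 2 ^ 2 \<Rightarrow> 'k vertex \<Rightarrow> 'k vertex" where
  "act g v = (\<lambda>L. (*v) g ` L) ` v"

definition ray_vertex :: "nat \<Rightarrow> 'k::field vertex" where
  "ray_vertex n =
     homothety_class ((*v) (vector [vector [fls_X_inv ^ n, 0], vector [0, 1]]) ` std_lattice)"

text \<open>
  Scalar matrices act trivially on homothety classes, so orbits of \<open>PGL\<^sub>2\<close> over the polynomial
  ring are orbits of \<open>GL\<^sub>2\<close>.
\<close>

definition height :: "'k::field vertex \<Rightarrow> nat" where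
  "height v = (THE n. \<exists>g\<in>poly_GL2. v = act g (ray_vertex n))"

datatype direction = Fwd | Bwd

text \<open>An oriented edge is a pair \<open>(z\<^sub>-\<^sub>1, z\<^sub>0)\<close> of adjacent vertices. The state \<open>(Fwd, 0)\<close> is empty.\<close>

fun has_state :: "'k::field vertex \<times> 'k vertex \<Rightarrow> direction \<Rightarrow> nat \<Rightarrow> bool" where
  "has_state (u, v) Fwd k \<longleftrightarrow> adjacent u v \<and> height v = k \<and> k = height u + 1"
| "has_state (u, v) Bwd k \<longleftrightarrow> adjacent u v \<and> height v = k \<and> height u = k + 1"

text \<open>Paths are indexed from \<open>0\<close>: \<open>p i\<close> is the vertex \<open>z\<close> with index \<open>i - 1\<close>.\<close>

definition Desc :: "nat \<Rightarrow> 'k::field vertex \<times> 'k vertex \<Rightarrow> 'k vertex set" where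
  "Desc N e = {p (N + 1) | p :: nat \<Rightarrow> 'k vertex.
     p 0 = fst e \<and> p 1 = snd e \<and>
     (\<forall>i\<le>N. adjacent (p i) (p (i + 1))) \<and>
     (\<forall>i<N. p (i + 2) \<noteq> p i)}"

text \<open>
  The value common to all oriented edges in the given state. The type argument supplies the finite
  field, which the remaining arguments do not mention.
\<close>

definition C_count ::
    "'k::{field,finite} itself \<Rightarrow> direction \<Rightarrow> nat \<Rightarrow> nat \<Rightarrow> nat \<Rightarrow> nat" where
  "C_count _ \<epsilon> k N j =
     (THE c. \<forall>e :: 'k vertex \<times> 'k vertex.
        has_state e \<epsilon> k \<longrightarrow> card {z \<in> Desc N e. height z = j} = c)"

text \<open>Measures on heights are given by their point masses.\<close>

definition mu ::
    "'k::{field,finite} itself \<Rightarrow> direction \<Rightarrow> nat \<Rightarrow> nat \<Rightarrow> nat \<Rightarrow> real" where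
  "mu K \<epsilon> k N j = real (C_count K \<epsilon> k N j) / real CARD('k) ^ N"

definition dirac :: "nat \<Rightarrow> nat \<Rightarrow> real" where
  "dirac m = indicator {m}"

end

theory Submission
  imports Defs
begin

text \<open>
  A forward edge of height \<open>k\<close> continues, without backtracking, to the unique neighbour of height
  \<open>k + 1\<close> (again forward) or to one of the \<open>q - 1\<close> neighbours of height \<open>k - 1\<close> other than the one it came
  from (then backward). Since the graph is a tree, the descendants through different neighbours
  are different vertices, so the counts add up:
  \<open>C\<^sup>f\<^sup>w\<^sup>d(k, N + 1) = C\<^sup>f\<^sup>w\<^sup>d(k + 1, N) + (q - 1) C\<^sup>b\<^sup>w\<^sup>d(k - 1, N)\<close>.
  Unrolling this recursion in the forward term gives the formula: the summand \<open>r\<close> counts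
  the paths with exactly \<open>r\<close> upward steps before the first downward one, and the term
  \<open>j = k + N\<close> the path that always goes up. Dividing by \<open>q\<^sup>N\<close> gives the statement about measures.

  The geometric input is proved with coordinates on the tree. Column operations over the ring of
  integers bring the basis of a lattice, up to homothety, to the columns \<open>(\<pi>\<^sup>n, 0)\<close> and
  \<open>(a, 1)\<close>, so a vertex is a closed ball \<open>a + \<pi>\<^sup>n\<O>\<close> in \<open>F\<close> (lemmas \<open>is_lattice_class_vert\<close> and
  \<open>vert_eq_iff\<close>). The neighbours of a ball are the ball of the next larger radius containing it and the
  \<open>q\<close> balls of the next smaller radius inside it (lemma \<open>adjacent_vert_iff\<close>): every vertex has exactly
  one parent, which points to the boundary point \<open>\<infinity>\<close>. A non-backtracking path therefore climbs
  for a while and then descends for the rest of its length, and is determined by its length and its two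
  ends (lemma \<open>nb_path_unique\<close>).

  The ray vertex \<open>v\<^sub>n\<close> is the ball \<open>\<pi>\<^sup>-\<^sup>n\<O>\<close>. Its parent is \<open>v\<^bsub>n+1\<^esub>\<close>, and polynomial
  translations carry all its children to \<open>\<pi>\<^bsup>1-n\<^esup>\<O>\<close>, which is \<open>v\<^bsub>n-1\<^esub>\<close>, or for \<open>n = 0\<close> is
  exchanged with \<open>v\<^sub>1\<close> by swapping the coordinates. Hence the orbits of the ray are closed under adjacency and
  exhaust the tree, and a comparison of degrees shows that they are distinct (lemma
  \<open>ray_vertices_inequivalent\<close>). This makes the height well defined and yields the
  heights of all neighbours (lemma \<open>neighbours_by_height\<close>).
\<close>

section \<open>Valuations of Laurent series\<close>

notation fls_nth (infixl "$$" 75)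
(* The dollar sign is left to the components of vectors. *)
no_notation fps_nth (infixl "$" 75)

text \<open>
  The valuation of \<open>f\<close> is at least \<open>n\<close>, that is, \<open>f \<in> \<pi>\<^sup>n\<O>\<close>. Stated through coefficients, the zero series needs
  no exception, although its \<open>fls_subdegree\<close> is \<open>0\<close>.
\<close>

definition val_ge :: "int \<Rightarrow> 'k::field fls \<Rightarrow> bool" where
  "val_ge n f \<longleftrightarrow> (\<forall>i<n. f $$ i = 0)"

lemma val_ge_subdegree: "f \<noteq> 0 \<Longrightarrow> val_ge n f \<longleftrightarrow> n \<le> fls_subdegree f"
  unfolding val_ge_def
  by (meson fls_eq0_below_subdegree fls_subdegree_geI nth_fls_subdegree_nonzero not_le order_less_le_trans)

lemma val_ge_0 [simp]: "val_ge n 0"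
  by (simp add: val_ge_def)

lemma val_ge_self: "val_ge (fls_subdegree f) f"
  by (simp add: val_ge_def)

lemma val_ge_add: "val_ge n f \<Longrightarrow> val_ge n g \<Longrightarrow> val_ge n (f + g)"
  by (simp add: val_ge_def)

lemma val_ge_diff: "val_ge n f \<Longrightarrow> val_ge n g \<Longrightarrow> val_ge n (f - g)"
  by (simp add: val_ge_def)

lemma val_ge_minus: "val_ge n (- f) \<longleftrightarrow> val_ge n f"
  by (simp add: val_ge_def)

lemma val_ge_mono: "val_ge n f \<Longrightarrow> m \<le> n \<Longrightarrow> val_ge m f"
  by (simp add: val_ge_def)

lemma val_ge_mult: "val_ge n f \<Longrightarrow> val_ge m g \<Longrightarrow> val_ge (n + m) (f * g)"
  by (cases "f = 0"; cases "g = 0") (auto simp: val_ge_subdegree)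

lemma val_ge_mult_0: "val_ge 0 f \<Longrightarrow> val_ge m g \<Longrightarrow> val_ge m (f * g)"
  using val_ge_mult[of 0 f m g] by simp

lemma val_ge_one [simp]: "val_ge 0 1"
  by (simp add: val_ge_def)

lemma val_ge_mult_iff: "f \<noteq> 0 \<Longrightarrow> val_ge n (f * g) \<longleftrightarrow> val_ge (n - fls_subdegree f) g"
  by (cases "g = 0") (auto simp: val_ge_subdegree)

lemma val_ge_divide_iff: "f \<noteq> 0 \<Longrightarrow> val_ge n (g / f) \<longleftrightarrow> val_ge (n + fls_subdegree f) g"
  using val_ge_mult_iff[of f "n + fls_subdegree f" "g / f"] by simp

lemma int_ring_eq: "int_ring = {f :: 'k::field fls. val_ge 0 f}"
proof -
  have "f \<in> range fps_to_fls" if "val_ge 0 f" for f :: "'k fls"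
  proof -
    have "f = fps_to_fls (fls_regpart f)"
      using that by (intro fls_eqI) (auto simp: val_ge_def)
    then show ?thesis by (rule range_eqI)
  qed
  then show ?thesis
    by (auto simp: int_ring_def val_ge_def)
qed

section \<open>Lattices and balls\<close>

text \<open>The \<open>\<O>\<close>-span of \<open>(\<pi>\<^sup>n, 0)\<close> and \<open>(a, 1)\<close>.\<close>

definition lat :: "int \<Rightarrow> 'k::field fls \<Rightarrow> ('k fls ^ 2) set" where
  "lat n a = {x. val_ge 0 (x $ 2) \<and> val_ge n (x $ 1 - a * x $ 2)}"

definition vert :: "int \<Rightarrow> 'k::field fls \<Rightarrow> 'k vertex" where
  "vert n a = homothety_class (lat n a)"

abbreviation vec2 :: "'a::zero \<Rightarrow> 'a \<Rightarrow> 'a ^ 2" where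
  "vec2 x y \<equiv> vector [x, y]"

lemma vec2_eq_iff: "(x :: 'a ^ 2) = y \<longleftrightarrow> x $ 1 = y $ 1 \<and> x $ 2 = y $ 2"
  by (simp add: vec_eq_iff forall_2)

lemma matrix_vector_mult_2:
  "((g :: 'a::semiring_1 ^ 2 ^ 2) *v x) $ i = g $ i $ 1 * x $ 1 + g $ i $ 2 * x $ 2"
  by (simp add: matrix_vector_mult_def sum_2)

lemma std_lattice_eq: "std_lattice = {x. val_ge 0 (x $ 1) \<and> val_ge 0 (x $ 2)}"
  by (simp add: std_lattice_def forall_2 int_ring_eq)

lemma lat_cong:
  assumes "val_ge n (a - b)"
  shows "lat n a = lat n b"
proof -
  have *: "lat n a \<subseteq> lat n b" if "val_ge n (a - b)" for a b :: "'a fls"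
  proof
    fix x assume "x \<in> lat n a"
    then have x: "val_ge 0 (x $ 2)" "val_ge n (x $ 1 - a * x $ 2)"
      by (auto simp: lat_def)
    have "val_ge n ((x $ 1 - a * x $ 2) + x $ 2 * (a - b))"
      using x that by (intro val_ge_add val_ge_mult_0)
    then show "x \<in> lat n b"
      using x by (simp add: lat_def algebra_simps)
  qed
  have "val_ge n (b - a)"
    using assms val_ge_minus[of n "b - a"] by simp
  then show ?thesis
    using assms * by blast
qed

text \<open>
  If the bottom entry \<open>w\<close> of the second column has no larger valuation than the other one, a column operation over \<open>\<O>\<close>
  clears that other bottom entry; after division by \<open>w\<close> the second column is \<open>(a, 1)\<close>, and the first one
  only matters up to a unit, so its valuation is read off from the determinant.
\<close>

lemma column_span_lat:
  fixes g :: "'k::field fls ^ 2 ^ 2"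
  assumes w: "g $ 2 $ 2 \<noteq> 0" and val: "val_ge (fls_subdegree (g $ 2 $ 2)) (g $ 2 $ 1)"
    and det: "det g \<noteq> 0"
  shows "(*v) g ` std_lattice =
    (*s) (g $ 2 $ 2) ` lat (fls_subdegree (det g) - 2 * fls_subdegree (g $ 2 $ 2)) (g $ 1 $ 2 / g $ 2 $ 2)"
    (is "_ = (*s) ?w ` lat ?n ?a")
proof -
  define w where "w = ?w"
  define a where "a = g $ 1 $ 2 / w"
  define z where "z = g $ 2 $ 1 / w"
  define u where "u = det g / (w * w)"
  have w0: "w \<noteq> 0" using w by (simp add: w_def)
  have u0: "u \<noteq> 0" using det w0 by (simp add: u_def)
  have a: "a = ?a" by (simp add: a_def w_def)
  have n: "?n = fls_subdegree u"
    using det w0 by (simp add: u_def fls_divide_subdegree flip: w_def)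
  have z: "val_ge 0 z"
    using val w0 by (simp add: z_def val_ge_divide_iff w_def)
  have g21: "g $ 2 $ 1 = w * z" and g22: "g $ 2 $ 2 = w" using w0 by (simp_all add: z_def w_def)
  have g12: "g $ 1 $ 2 = w * a" using w0 by (simp add: a_def)
  have g11: "g $ 1 $ 1 = w * (u + a * z)"
    using w0 by (simp add: u_def z_def a_def w_def det_2 field_simps)
  show ?thesis
    unfolding a [symmetric]
  proof (intro equalityI subsetI)
    fix y assume "y \<in> (*v) g ` std_lattice"
    then obtain x where x: "val_ge 0 (x $ 1)" "val_ge 0 (x $ 2)" and y: "y = g *v x"
      unfolding std_lattice_eq by blast
    let ?y = "vec2 ((u + a * z) * x $ 1 + a * x $ 2) (z * x $ 1 + x $ 2)"
    have "y = w *s ?y"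
      unfolding y vec2_eq_iff
      by (simp only: matrix_vector_mult_2 vector_smult_component vector_2 g11 g12 g21 g22)
        (simp add: algebra_simps)
    moreover have "?y \<in> lat ?n a"
    proof -
      have "val_ge 0 (z * x $ 1 + x $ 2)"
        using x z by (intro val_ge_add val_ge_mult_0)
      moreover have "(u + a * z) * x $ 1 + a * x $ 2 - a * (z * x $ 1 + x $ 2) = u * x $ 1"
        by (simp add: algebra_simps)
      moreover have "val_ge ?n (u * x $ 1)"
        using x u0 n by (simp add: val_ge_mult_iff)
      ultimately show ?thesis by (simp only: lat_def mem_Collect_eq vector_2)
    qed
    ultimately show "y \<in> (*s) ?w ` lat ?n a" unfolding w_def by (rule image_eqI)
  next
    fix y assume "y \<in> (*s) ?w ` lat ?n a"
    then obtain x where x: "val_ge 0 (x $ 2)" "val_ge ?n (x $ 1 - a * x $ 2)" and y: "y = w *s x"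
      by (auto simp: lat_def w_def)
    define s where "s = (x $ 1 - a * x $ 2) / u"
    let ?x = "vec2 s (x $ 2 - z * s)"
    have us: "u * s = x $ 1 - a * x $ 2" using u0 by (simp add: s_def)
    have s: "val_ge 0 s"
      using x u0 n by (simp add: s_def val_ge_divide_iff)
    have "?x \<in> std_lattice"
      using x z s by (simp add: std_lattice_eq val_ge_diff val_ge_mult_0)
    moreover have "y = g *v ?x"
    proof -
      have "y $ 1 = w * (u * s + a * x $ 2)" unfolding us by (simp add: y)
      also have "\<dots> = (g *v ?x) $ 1"
        by (simp only: matrix_vector_mult_2 vector_2 g11 g12) (simp add: algebra_simps)
      finally show ?thesis
        unfolding vec2_eq_iff
        by (simp only: matrix_vector_mult_2 vector_2 g21 g22) (simp add: y algebra_simps)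
    qed
    ultimately show "y \<in> (*v) g ` std_lattice" by blast
  qed
qed

lemma std_lattice_swap_columns:
  fixes g :: "'k::field fls ^ 2 ^ 2"
  shows "(*v) g ` std_lattice =
    (*v) (vec2 (vec2 (g $ 1 $ 2) (g $ 1 $ 1)) (vec2 (g $ 2 $ 2) (g $ 2 $ 1))) ` std_lattice"
    (is "_ = (*v) ?h ` _")
proof -
  have "g *v x = ?h *v vec2 (x $ 2) (x $ 1)" "?h *v x = g *v vec2 (x $ 2) (x $ 1)" for x
    by (simp_all add: vec2_eq_iff matrix_vector_mult_2 add.commute)
  moreover have "vec2 (x $ 2) (x $ 1) \<in> std_lattice" if "x \<in> std_lattice" for x :: "'k fls ^ 2"
    using that by (simp add: std_lattice_eq)
  ultimately have "(*v) g ` std_lattice \<subseteq> (*v) ?h ` std_lattice" "(*v) ?h ` std_lattice \<subseteq> (*v) g ` std_lattice"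
    by (metis image_eqI image_subsetI)+
  then show ?thesis by blast
qed

text \<open>
  Exchanging the two columns, if necessary, puts a nonzero bottom entry of minimal valuation into the
  second column.
\<close>

lemma is_lattice_obtain_lat:
  fixes L :: "('k::field fls ^ 2) set"
  assumes "is_lattice L"
  obtains c n a where "c \<noteq> 0" "L = (*s) c ` lat n a"
proof -
  obtain g :: "'k fls ^ 2 ^ 2" where g: "invertible g" "L = (*v) g ` std_lattice"
    using assms by (auto simp: is_lattice_def)
  have det: "det g \<noteq> 0" using g invertible_det_nz by blast
  let ?h = "vec2 (vec2 (g $ 1 $ 2) (g $ 1 $ 1)) (vec2 (g $ 2 $ 2) (g $ 2 $ 1))"
  have dh: "det ?h = - det g" by (simp add: det_2)
  consider "g $ 2 $ 2 \<noteq> 0" "val_ge (fls_subdegree (g $ 2 $ 2)) (g $ 2 $ 1)"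
    | "g $ 2 $ 1 \<noteq> 0" "val_ge (fls_subdegree (g $ 2 $ 1)) (g $ 2 $ 2)"
  proof (cases "g $ 2 $ 2 = 0 \<or> g $ 2 $ 1 = 0")
    case True
    then show ?thesis using det that by (auto simp: det_2)
  next
    case False
    then show ?thesis using that by (cases "fls_subdegree (g $ 2 $ 2) \<le> fls_subdegree (g $ 2 $ 1)") (auto simp: val_ge_subdegree)
  qed
  then show ?thesis
  proof cases
    case 1
    then show ?thesis using column_span_lat[OF 1 det] that g by metis
  next
    case 2
    then have "(*v) ?h ` std_lattice = (*s) (?h $ 2 $ 2) ` lat (fls_subdegree (det ?h) - 2 * fls_subdegree (?h $ 2 $ 2)) (?h $ 1 $ 2 / ?h $ 2 $ 2)"
      using det dh by (intro column_span_lat) auto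
    then show ?thesis using that g 2 std_lattice_swap_columns[of g] by (metis vector_2(2))
  qed
qed

lemma upper_triangular_image_std_lattice:
  fixes u a :: "'k::field fls"
  assumes "u \<noteq> 0"
  shows "(*v) (vec2 (vec2 u a) (vec2 0 1)) ` std_lattice = lat (fls_subdegree u) a"
proof -
  have "det (vec2 (vec2 u a) (vec2 0 1)) = u" by (simp add: det_2)
  moreover have "(*s) 1 ` S = S" for S :: "('k fls ^ 2) set" by simp
  ultimately show ?thesis
    using column_span_lat[of "vec2 (vec2 u a) (vec2 0 1)"] assms by simp
qed

lemma is_lattice_lat: "is_lattice (lat n (a :: 'k::field fls))"
proof -
  let ?g = "vec2 (vec2 (fls_X_intpow n) a) (vec2 0 1) :: 'k fls ^ 2 ^ 2"
  have "det ?g \<noteq> 0" by (simp add: det_2)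
  then show ?thesis
    unfolding is_lattice_def
    by (intro exI[of _ ?g]) (simp add: upper_triangular_image_std_lattice invertible_det_nz)
qed

lemma ray_vertex_eq_vert: "ray_vertex n = vert (- int n) 0"
  by (simp add: ray_vertex_def vert_def upper_triangular_image_std_lattice)

lemma homothety_class_scale:
  assumes "c \<noteq> (0 :: 'k::field fls)"
  shows "homothety_class ((*s) c ` L) = homothety_class L"
proof -
  have *: "(*s) b ` (*s) d ` M = (*s) (b * d) ` M" for b d :: "'k fls" and M
    by (simp add: image_image)
  show ?thesis
  proof (intro equalityI subsetI)
    fix M assume "M \<in> homothety_class ((*s) c ` L)"
    then obtain b where "M = (*s) (b * c) ` L" "b \<noteq> 0"
      unfolding homothety_class_def * by blast
    then show "M \<in> homothety_class L"
      unfolding homothety_class_def using assms mult_eq_0_iff[of b c] by blast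
  next
    fix M assume "M \<in> homothety_class L"
    then obtain b where b: "M = (*s) b ` L" "b \<noteq> 0"
      unfolding homothety_class_def by blast
    then have "M = (*s) (b / c) ` (*s) c ` L" "b / c \<noteq> 0"
      using assms by (simp_all add: *)
    then show "M \<in> homothety_class ((*s) c ` L)"
      unfolding homothety_class_def by blast
  qed
qed

lemma homothety_class_eq_iff:
  "homothety_class L = homothety_class L' \<longleftrightarrow> (\<exists>c :: 'k::field fls. c \<noteq> 0 \<and> L = (*s) c ` L')"
proof
  assume "homothety_class L = homothety_class L'"
  moreover have "L \<in> homothety_class L"
    by (auto simp: homothety_class_def intro!: exI[of _ 1])
  ultimately show "\<exists>c. c \<noteq> 0 \<and> L = (*s) c ` L'"
    by (auto simp: homothety_class_def)
qed (auto simp: homothety_class_scale)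

lemma vert_cong: "val_ge n (a - b) \<Longrightarrow> vert n a = vert n b"
  by (simp add: vert_def lat_cong)

lemma mem_scale_iff:
  assumes "c \<noteq> (0 :: 'k::field fls)"
  shows "x \<in> (*s) c ` L \<longleftrightarrow> (1 / c) *s x \<in> L"
proof
  assume "(1 / c) *s x \<in> L"
  moreover have "x = c *s ((1 / c) *s x)" using assms by (simp add: vector_smult_assoc)
  ultimately show "x \<in> (*s) c ` L" by blast
qed (use assms in \<open>auto simp: vector_smult_assoc\<close>)

text \<open>
  If \<open>c\<close> scales one normalised lattice onto another, comparing the projections to the second
  coordinate shows that \<open>c\<close> is a unit. Then the intersections with the first axis give the same \<open>n\<close>, and the
  image of \<open>(b, 1)\<close> compares the centres.
\<close>

lemma vert_eq_iff:
  fixes a b :: "'k::field fls"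
  shows "vert n a = vert m b \<longleftrightarrow> n = m \<and> val_ge n (a - b)"
proof
  assume "vert n a = vert m b"
  then obtain c where c: "c \<noteq> 0" "lat n a = (*s) c ` lat m b"
    by (auto simp: vert_def homothety_class_eq_iff)
  have mem: "c *s x \<in> lat n a" if "x \<in> lat m b" for x using that c by blast
  have mem': "(1 / c) *s x \<in> lat m b" if "x \<in> lat n a" for x
    using that c mem_scale_iff by blast
  define X where "X k = (fls_X_intpow k :: 'k fls)" for k
  have X: "X k \<noteq> 0" "fls_subdegree (X k) = k" for k by (simp_all add: X_def)
  have vX: "val_ge k (X k)" for k by (simp add: val_ge_subdegree X)
  have 1: "val_ge 0 c" "val_ge n (c * b - a * c)"
    using mem[of "vec2 b 1"] by (auto simp: lat_def)
  have 2: "val_ge 0 (1 / c)"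
    using mem'[of "vec2 a 1"] by (auto simp: lat_def)
  have c0: "fls_subdegree c = 0"
    using 1(1) 2 c(1) val_ge_divide_iff[of c 0 1] by (auto simp: val_ge_subdegree)
  have "val_ge n (c * X m)"
    using mem[of "vec2 (X m) 0"] by (auto simp: lat_def vX)
  then have "n \<le> m" using c c0 by (simp add: val_ge_subdegree X)
  have "val_ge m (1 / c * X n)"
    using mem'[of "vec2 (X n) 0"] by (auto simp: lat_def vX)
  then have "val_ge m (X n)" using c(1) c0 val_ge_divide_iff[of c m "X n"] by simp
  then have "m \<le> n" by (simp add: val_ge_subdegree X)
  have "c * b - a * c = c * (b - a)" by (simp add: algebra_simps)
  then have "val_ge n (b - a)" using 1 c c0 by (simp add: val_ge_mult_iff)
  then show "n = m \<and> val_ge n (a - b)"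
    using \<open>n \<le> m\<close> \<open>m \<le> n\<close> val_ge_minus[of n "a - b"] by simp
qed (auto simp: vert_cong)


section \<open>Neighbours of a ball\<close>

definition mon :: "int \<Rightarrow> 'k::field \<Rightarrow> 'k fls" where
  "mon n c = fls_shift (- n) (fls_const c)"

lemma mon_nth: "mon n c $$ i = (if i = n then c else 0)"
  by (simp add: mon_def)

lemma mon_mult_nth: "(mon n c * f) $$ i = c * f $$ (i - n)"
proof -
  have "mon n c = fls_X_intpow n * fls_const c"
    by (simp add: mon_def fls_X_intpow_times_conv_shift)
  then have "mon n c * f = fls_shift (- n) (fls_const c * f)"
    by (metis mult.assoc fls_X_intpow_times_conv_shift(1))
  then show ?thesis by simp
qed

lemma mon_0 [simp]: "mon n 0 = 0"
  by (simp add: mon_def)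

lemma mon_0_1 [simp]: "mon 0 1 = 1"
  by (simp add: mon_def)

lemma mon_neq_0 [simp]: "c \<noteq> 0 \<Longrightarrow> mon n c \<noteq> 0"
  by (metis fls_zero_nth mon_nth)

lemma subdegree_mon [simp]: "c \<noteq> 0 \<Longrightarrow> fls_subdegree (mon n c) = n"
  by (rule fls_subdegree_eqI) (simp_all add: mon_nth)

lemma val_ge_mon: "val_ge n (mon n c)"
  by (simp add: val_ge_def mon_nth)

lemma fls_X_eq_mon: "fls_X = mon 1 1"
  by (rule fls_eqI) (simp add: mon_nth)

lemma val_ge_Suc: "val_ge (n + 1) f \<longleftrightarrow> val_ge n f \<and> f $$ n = 0"
  by (force simp: val_ge_def zless_add1_eq)

lemma val_ge_1: "val_ge 1 f \<longleftrightarrow> val_ge 0 f \<and> f $$ 0 = 0"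
  using val_ge_Suc[of 0 f] by simp

text \<open>The lowest coefficient is linear over the residue map \<open>\<O> \<rightarrow> \<kappa>\<close> to the coefficient field \<open>\<kappa>\<close>.\<close>

lemma int_mult_nth:
  assumes "val_ge 0 r" "val_ge n f"
  shows "(r * f) $$ n = r $$ 0 * f $$ n"
proof -
  have "val_ge (0 + 1) (r - mon 0 (r $$ 0))"
    unfolding val_ge_Suc using assms by (simp add: val_ge_def mon_nth)
  then have "val_ge (1 + n) ((r - mon 0 (r $$ 0)) * f)"
    using assms(2) by (intro val_ge_mult) simp_all
  then have "((r - mon 0 (r $$ 0)) * f) $$ n = 0"
    by (simp add: val_ge_def)
  then show ?thesis
    by (simp add: left_diff_distrib mon_mult_nth)
qed

text \<open>
  The coordinates, in the residue field, of the reduction of a vector of \<open>lat n a\<close> with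
  respect to the basis \<open>(\<pi>\<^sup>n, 0)\<close>, \<open>(a, 1)\<close>. They identify \<open>L / \<pi>L\<close> with \<open>\<kappa>\<^sup>2\<close>, and the sublattices
  strictly between \<open>\<pi>L\<close> and \<open>L\<close> with the lines through \<open>0\<close> in the plane \<open>\<kappa>\<^sup>2\<close>.
\<close>

definition res1 :: "int \<Rightarrow> 'k::field fls \<Rightarrow> 'k fls ^ 2 \<Rightarrow> 'k" where
  "res1 n a x = (x $ 1 - a * x $ 2) $$ n"

definition res2 :: "'k::field fls ^ 2 \<Rightarrow> 'k" where
  "res2 x = x $ 2 $$ 0"

lemma res_add:
  "res1 n a (x + y) = res1 n a x + res1 n a y" "res2 (x + y) = res2 x + res2 y"
  by (simp_all add: res1_def res2_def algebra_simps)

lemma res_scale: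
  assumes "val_ge 0 r" "x \<in> lat n a"
  shows "res1 n a (r *s x) = r $$ 0 * res1 n a x" "res2 (r *s x) = r $$ 0 * res2 x"
proof -
  have "r * x $ 1 - a * (r * x $ 2) = r * (x $ 1 - a * x $ 2)" by (simp add: algebra_simps)
  then show "res1 n a (r *s x) = r $$ 0 * res1 n a x"
    using assms by (simp add: res1_def lat_def int_mult_nth)
  show "res2 (r *s x) = r $$ 0 * res2 x"
    using assms by (simp add: res2_def lat_def int_mult_nth)
qed

lemma res_surj: "\<exists>x\<in>lat n a. res1 n a x = r \<and> res2 x = t"
  by (rule bexI[of _ "vec2 (mon n r + a * mon 0 t) (mon 0 t)"])
    (simp_all add: res1_def res2_def lat_def val_ge_mon mon_nth)

text \<open>The line through \<open>(c, 1)\<close> gives the ball of the next smaller radius around \<open>a + c\<pi>\<^sup>n\<close>.\<close>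

lemma lat_child:
  "lat (n + 1) (a + mon n c) = {x \<in> lat n a. res1 n a x = c * res2 x}"
proof -
  have "val_ge (n + 1) (x $ 1 - (a + mon n c) * x $ 2) \<longleftrightarrow>
      val_ge n (x $ 1 - a * x $ 2) \<and> res1 n a x = c * res2 x" if "val_ge 0 (x $ 2)" for x
  proof -
    have eq: "x $ 1 - (a + mon n c) * x $ 2 = (x $ 1 - a * x $ 2) - mon n c * x $ 2"
      by (simp add: algebra_simps)
    have v: "val_ge n (mon n c * x $ 2)"
      using val_ge_mult[OF val_ge_mon that] by simp
    have "val_ge n ((x $ 1 - a * x $ 2) - mon n c * x $ 2) \<longleftrightarrow> val_ge n (x $ 1 - a * x $ 2)"
      using v by (metis diff_add_cancel val_ge_add val_ge_diff)
    then show ?thesis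
      unfolding val_ge_Suc eq by (auto simp: mon_mult_nth res1_def res2_def)
  qed
  then show ?thesis by (auto simp: lat_def)
qed

lemma scaled_lat_eq:
  "(*s) fls_X ` lat m a = {x. val_ge 1 (x $ 2) \<and> val_ge (m + 1) (x $ 1 - a * x $ 2)}"
proof -
  define X where "X = (fls_X :: 'a fls)"
  have X: "X \<noteq> 0" "fls_subdegree X = 1" by (simp_all add: X_def)
  have "x $ 1 / X - a * (x $ 2 / X) = (x $ 1 - a * x $ 2) / X" for x :: "'a fls ^ 2"
    using X by (simp add: field_simps)
  then have "(1 / X) *s x \<in> lat m a \<longleftrightarrow>
      val_ge 1 (x $ 2) \<and> val_ge (m + 1) (x $ 1 - a * x $ 2)" for x
    using X val_ge_divide_iff[OF X(1)] by (simp add: lat_def)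
  then show ?thesis using mem_scale_iff[OF X(1)] unfolding X_def by blast
qed

text \<open>The remaining line \<open>(1, 0)\<close> gives, after division by \<open>\<pi>\<close>, the next larger ball.\<close>

lemma lat_parent: "(*s) fls_X ` lat (n - 1) a = {x \<in> lat n a. res2 x = 0}"
  unfolding scaled_lat_eq by (auto simp: lat_def res2_def val_ge_1)

lemma lat_scaled: "(*s) fls_X ` lat n a = {x \<in> lat n a. res1 n a x = 0 \<and> res2 x = 0}"
  unfolding scaled_lat_eq by (auto simp: lat_def res1_def res2_def val_ge_1 val_ge_Suc)

lemma vector_mult_scale: "(g :: 'a::comm_semiring_1 ^ 2 ^ 2) *v (c *s x) = c *s (g *v x)"
  by (simp add: vec2_eq_iff matrix_vector_mult_2 algebra_simps)

lemma is_lattice_image: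
  assumes "invertible g" "is_lattice L"
  shows "is_lattice ((*v) g ` L)"
proof -
  obtain h where "invertible h" "L = (*v) h ` std_lattice"
    using assms by (auto simp: is_lattice_def)
  then have "invertible (g ** h)" "(*v) g ` L = (*v) (g ** h) ` std_lattice"
    using assms by (simp_all add: invertible_mult image_image matrix_vector_mul_assoc)
  then show ?thesis unfolding is_lattice_def by blast
qed

lemma is_lattice_scale:
  assumes "c \<noteq> (0 :: 'k::field fls)" "is_lattice L"
  shows "is_lattice ((*s) c ` L)"
proof -
  let ?g = "vec2 (vec2 c 0) (vec2 0 c)"
  have "invertible ?g" using assms by (simp add: invertible_det_nz det_2)
  moreover have "(*v) ?g = (*s) c"
    by (rule ext) (simp add: vec2_eq_iff matrix_vector_mult_2)
  ultimately show ?thesis using is_lattice_image[OF _ assms(2)] by metis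
qed

lemma adjacent_residue_kernel:
  fixes \<alpha> \<beta> :: "'k::field"
  assumes nz: "\<alpha> \<noteq> 0 \<or> \<beta> \<noteq> 0"
    and K: "K = {x \<in> lat n a. \<alpha> * res1 n a x + \<beta> * res2 x = 0}" "is_lattice K"
  shows "adjacent (vert n a) (homothety_class K)"
proof -
  let ?\<phi> = "\<lambda>x. \<alpha> * res1 n a x + \<beta> * res2 x"
  have surj: "\<exists>x\<in>lat n a. ?\<phi> x = y" for y
  proof (cases "\<alpha> = 0")
    case True
    obtain x where "x \<in> lat n a" "res1 n a x = 0" "res2 x = y / \<beta>"
      using res_surj by blast
    then show ?thesis using True nz by (intro bexI[of _ x]) simp_all
  next
    case False
    obtain x where "x \<in> lat n a" "res1 n a x = y / \<alpha>" "res2 x = 0"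
      using res_surj by blast
    then show ?thesis using False by (intro bexI[of _ x]) simp_all
  qed
  have "(*s) fls_X ` lat n a \<subset> K"
  proof -
    \<comment> \<open>The vector \<open>(\<beta>, - \<alpha>)\<close> spans the kernel of the form \<open>(\<alpha>, \<beta>)\<close>.\<close>
    obtain x where "x \<in> lat n a" "res1 n a x = \<beta>" "res2 x = - \<alpha>"
      using res_surj by blast
    then have "x \<in> K - (*s) fls_X ` lat n a"
      using nz by (auto simp: K lat_scaled)
    then show ?thesis by (auto simp: K lat_scaled)
  qed
  moreover have "K \<subset> lat n a"
  proof -
    obtain x where "x \<in> lat n a" "?\<phi> x = 1" using surj by blast
    then have "x \<in> lat n a - K" by (simp add: K)
    then show ?thesis by (auto simp: K)
  qed
  moreover have "quotient_iso_residue_field (lat n a) K"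
    unfolding quotient_iso_residue_field_def
  proof (intro exI[of _ ?\<phi>] conjI ballI)
    show "?\<phi> ` lat n a = UNIV"
      using surj by (metis (no_types, lifting) image_iff surj_def UNIV_eq_I)
  qed (auto simp: K res_add res_scale int_ring_eq algebra_simps)
  ultimately show ?thesis
    unfolding adjacent_def vert_def using is_lattice_lat K by blast
qed

lemma adjacent_parent: "adjacent (vert n a) (vert (n - 1) a)"
proof -
  have "fls_X \<noteq> (0 :: 'a fls)" by (simp add: fls_X_eq_mon)
  then have "is_lattice ((*s) fls_X ` lat (n - 1) a)"
    "homothety_class ((*s) fls_X ` lat (n - 1) a) = vert (n - 1) a"
    by (simp_all add: is_lattice_scale is_lattice_lat homothety_class_scale vert_def)
  then show ?thesis
    using adjacent_residue_kernel[of 0 1 _ n a] by (simp add: lat_parent)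
qed

lemma adjacent_child: "adjacent (vert n a) (vert (n + 1) (a + mon n c))"
  unfolding vert_def [of "n + 1"]
  by (rule adjacent_residue_kernel[of 1 "- c"]) (simp_all add: is_lattice_lat, simp add: lat_child)

text \<open>
  A linear form \<open>\<phi>\<close> on \<open>L\<close> that is compatible with \<open>\<O> \<rightarrow> \<kappa>\<close> is a linear form \<open>(\<alpha>, \<beta>)\<close> in the
  residue coordinates, and a neighbour is determined by the line on which the form vanishes.
\<close>

lemma adjacent_vert_cases:
  fixes a :: "'k::field fls"
  assumes "adjacent (vert n a) w"
  shows "w = vert (n - 1) a \<or> (\<exists>c. w = vert (n + 1) (a + mon n c))"
proof -
  obtain L L' \<phi> where L: "vert n a = homothety_class L" and w: "w = homothety_class L'"
    and add: "\<forall>x\<in>L. \<forall>y\<in>L. \<phi> (x + y) = \<phi> x + \<phi> y"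
    and scale: "\<forall>r\<in>int_ring. \<forall>x\<in>L. \<phi> (r *s x) = fls_nth r 0 * \<phi> x"
    and surj: "\<phi> ` L = UNIV" and ker: "{x \<in> L. \<phi> x = 0} = L'"
    using assms by (auto simp: adjacent_def quotient_iso_residue_field_def)
  obtain c where c: "c \<noteq> 0" "L = (*s) c ` lat n a"
    using L homothety_class_eq_iff[of L "lat n a"] by (auto simp: vert_def)
  define \<alpha> where "\<alpha> = \<phi> (c *s vec2 (mon n 1) 0)"
  define \<beta> where "\<beta> = \<phi> (c *s vec2 a 1)"
  have \<phi>: "\<phi> (c *s x) = \<alpha> * res1 n a x + \<beta> * res2 x" if x: "x \<in> lat n a" for x
  proof -
    define r where "r = (x $ 1 - a * x $ 2) / mon n 1"
    have r: "r \<in> int_ring" and x2: "x $ 2 \<in> int_ring"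
      using x by (simp_all add: r_def int_ring_eq val_ge_divide_iff lat_def)
    have rm: "mon n 1 * r = x $ 1 - a * x $ 2" by (simp add: r_def)
    have r0: "r $$ 0 = res1 n a x"
      using mon_mult_nth[of n 1 r n] by (simp add: rm res1_def)
    let ?y = "c *s vec2 (mon n 1) 0" and ?z = "c *s vec2 a 1"
    have yz: "vec2 (mon n 1) 0 \<in> lat n a" "vec2 a 1 \<in> lat n a"
      by (simp_all add: lat_def val_ge_mon)
    have "vec2 (r * mon n 1) 0 \<in> lat n a" "vec2 (x $ 2 * a) (x $ 2) \<in> lat n a"
      using x2 r val_ge_mult[OF _ val_ge_mon, of 0 r n 1] by (simp_all add: lat_def int_ring_eq)
    moreover have "r *s ?y = c *s vec2 (r * mon n 1) 0" "x $ 2 *s ?z = c *s vec2 (x $ 2 * a) (x $ 2)"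
      by (simp_all add: vec2_eq_iff)
    ultimately have mem: "r *s ?y \<in> L" "x $ 2 *s ?z \<in> L" "?y \<in> L" "?z \<in> L"
      using yz c by auto
    have "c *s x = r *s ?y + x $ 2 *s ?z"
      using rm by (simp add: vec2_eq_iff) (metis (no_types, opaque_lifting) add.commute diff_add_cancel distrib_left mult.left_commute mult.commute)
    then have "\<phi> (c *s x) = \<phi> (r *s ?y) + \<phi> (x $ 2 *s ?z)"
      using add mem by metis
    also have "\<dots> = r $$ 0 * \<alpha> + x $ 2 $$ 0 * \<beta>"
      unfolding \<alpha>_def \<beta>_def using scale mem r x2 by metis
    finally have "\<phi> (c *s x) = r $$ 0 * \<alpha> + x $ 2 $$ 0 * \<beta>" .
    then show ?thesis by (simp add: r0 res2_def)
  qed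
  have "\<alpha> \<noteq> 0 \<or> \<beta> \<noteq> 0"
  proof (rule ccontr)
    assume "\<not> ?thesis"
    then have "\<phi> y = 0" if "y \<in> L" for y using that \<phi> c by auto
    moreover obtain y where "y \<in> L" "\<phi> y = 1" using surj by (metis UNIV_I imageE)
    ultimately show False by simp
  qed
  define K where "K = {x \<in> lat n a. \<alpha> * res1 n a x + \<beta> * res2 x = 0}"
  have "L' = (*s) c ` K"
    unfolding K_def ker [symmetric] c using \<phi> by auto
  then have wK: "w = homothety_class K"
    using c w by (simp add: homothety_class_scale)
  show ?thesis
  proof (cases "\<alpha> = 0")
    case True
    then have "K = (*s) fls_X ` lat (n - 1) a"
      using \<open>\<alpha> \<noteq> 0 \<or> \<beta> \<noteq> 0\<close> by (simp add: K_def lat_parent)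
    moreover have "fls_X \<noteq> (0 :: 'k fls)" by (simp add: fls_X_eq_mon)
    ultimately show ?thesis using wK by (simp add: vert_def homothety_class_scale)
  next
    case False
    then have "\<alpha> * r + \<beta> * t = 0 \<longleftrightarrow> r = - \<beta> / \<alpha> * t" for r t
      by (simp add: field_simps eq_neg_iff_add_eq_0)
    then have "K = lat (n + 1) (a + mon n (- \<beta> / \<alpha>))"
      unfolding K_def lat_child by simp
    then show ?thesis using wK by (auto simp: vert_def)
  qed
qed

lemma adjacent_vert_iff:
  "adjacent (vert n a) w \<longleftrightarrow> w = vert (n - 1) a \<or> (\<exists>c. w = vert (n + 1) (a + mon n c))"
  using adjacent_vert_cases adjacent_parent adjacent_child by blast

lemma is_lattice_class_vert:
  assumes "is_lattice L"
  shows "\<exists>n a. homothety_class L = vert n a"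
  using is_lattice_obtain_lat[OF assms] homothety_class_scale vert_def by metis

lemma adjacent_imp_vert:
  assumes "adjacent v w"
  obtains n a where "v = vert n a"
  using assms is_lattice_class_vert unfolding adjacent_def by metis

lemma adjacent_sym:
  assumes "adjacent v w"
  shows "adjacent w v"
proof -
  obtain n a where v: "v = vert n a" using assms adjacent_imp_vert by blast
  from assms consider "w = vert (n - 1) a" | c where "w = vert (n + 1) (a + mon n c)"
    unfolding v adjacent_vert_iff by blast
  then show ?thesis
  proof cases
    case 1
    then show ?thesis using adjacent_child[of "n - 1" a 0] by (simp add: v)
  next
    case 2
    then have "adjacent w (vert n (a + mon n c))"
      using adjacent_parent[of "n + 1" "a + mon n c"] by simp
    moreover have "vert n (a + mon n c) = v"
      by (simp add: v vert_eq_iff val_ge_mon)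
    ultimately show ?thesis by simp
  qed
qed


section \<open>The action of the modular group\<close>

lemma act_homothety_class: "act g (homothety_class L) = homothety_class ((*v) g ` L)"
proof -
  have "(*v) g ` (*s) c ` L = (*s) c ` (*v) g ` L" for c
    by (simp add: image_image vector_mult_scale)
  moreover have "act g (homothety_class L) = {(*v) g ` (*s) c ` L | c. c \<noteq> 0}"
    unfolding act_def homothety_class_def by blast
  ultimately show ?thesis by (simp add: homothety_class_def)
qed

lemma act_mult: "act (g ** h) v = act g (act h v)"
  by (simp add: act_def image_image matrix_vector_mul_assoc)

lemma act_one: "act (mat 1) v = v"
  by (simp add: act_def)

lemma adjacent_act:
  assumes "invertible g" "adjacent v w"
  shows "adjacent (act g v) (act g w)"
proof -
  obtain h where h: "g ** h = mat 1" "h ** g = mat 1"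
    using assms by (auto simp: invertible_def)
  have hg: "h *v (g *v x) = x" for x by (simp add: matrix_vector_mul_assoc h)
  have inj: "inj ((*v) g)" by (metis hg injI)
  obtain L L' \<phi> where L: "is_lattice L" "is_lattice L'" "v = homothety_class L" "w = homothety_class L'"
      and sub: "(*s) fls_X ` L \<subset> L'" "L' \<subset> L"
    and \<phi>: "\<forall>x\<in>L. \<forall>y\<in>L. \<phi> (x + y) = \<phi> x + \<phi> y"
      "\<forall>a\<in>int_ring. \<forall>x\<in>L. \<phi> (a *s x) = fls_nth a 0 * \<phi> x"
      "\<phi> ` L = UNIV" "{x \<in> L. \<phi> x = 0} = L'"
    using assms by (auto simp: adjacent_def quotient_iso_residue_field_def)
  have strict: "(*v) g ` S \<subset> (*v) g ` T" if "S \<subset> T" for S T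
    using that inj by (metis image_strict_mono inj_on_subset subset_UNIV)
  have "(*s) fls_X ` (*v) g ` L = (*v) g ` (*s) fls_X ` L"
    by (simp add: image_image vector_mult_scale)
  then have "(*s) fls_X ` (*v) g ` L \<subset> (*v) g ` L'"
    using strict sub by simp
  moreover have "(*v) g ` L' \<subset> (*v) g ` L" using strict sub by simp
  moreover have "quotient_iso_residue_field ((*v) g ` L) ((*v) g ` L')"
    unfolding quotient_iso_residue_field_def
  proof (intro exI[of _ "\<lambda>x. \<phi> (h *v x)"] conjI)
    show "(\<lambda>x. \<phi> (h *v x)) ` (*v) g ` L = UNIV"
      using \<phi>(3) by (simp add: image_image hg)
    show "{x \<in> (*v) g ` L. \<phi> (h *v x) = 0} = (*v) g ` L'"
      unfolding \<phi>(4) [symmetric] by (auto simp: hg)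
  qed (use \<phi>(1,2) in \<open>auto simp: hg matrix_vector_right_distrib vector_mult_scale\<close>)
  ultimately show ?thesis
    unfolding adjacent_def L(3,4) act_homothety_class using L(1,2) assms is_lattice_image by blast
qed

lemma nth_poly_X_inv:
  fixes p :: "'k::field poly"
  shows "poly (map_poly fls_const p) fls_X_inv $$ i = (if i \<le> 0 then coeff p (nat (- i)) else 0)"
proof (induction p arbitrary: i)
  case (pCons a p)
  have "(fls_X_inv * f) $$ i = f $$ (i + 1)" for f :: "'k fls"
    by (simp add: fls_X_inv_times_conv_shift)
  then have "poly (map_poly fls_const (pCons a p)) fls_X_inv $$ i =
      fls_const a $$ i + (if i + 1 \<le> 0 then coeff p (nat (- (i + 1))) else 0)"
    using pCons.IH by (simp add: map_poly_pCons)
  moreover have "coeff (pCons a p) (nat (- i)) = coeff p (nat (- (i + 1)))" if "i < 0"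
  proof -
    have "nat (- i) = Suc (nat (- (i + 1)))" using that by simp
    then show ?thesis by (simp only: coeff_pCons_Suc)
  qed
  ultimately show ?case by simp
qed simp

text \<open>
  A Laurent series in \<open>1/t\<close> has only finitely many terms of negative index, so it is a polynomial in
  \<open>t\<close> as soon as it has no terms of positive index.
\<close>

lemma poly_ring_eq: "poly_ring = {f :: 'k::field fls. \<forall>i>0. f $$ i = 0}"
proof -
  have "f \<in> poly_ring" if "\<forall>i>0. f $$ i = 0" for f :: "'k fls"
  proof -
    let ?p = "[:f $$ 0:] + fls_prpart f"
    have "f $$ i = poly (map_poly fls_const ?p) fls_X_inv $$ i" for i
      using that by (cases "i > 0") (auto simp: nth_poly_X_inv coeff_pCons split: nat.splits)
    then have "f = poly (map_poly fls_const ?p) fls_X_inv" by (intro fls_eqI)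
    then show ?thesis by (auto simp: poly_ring_def)
  qed
  then show ?thesis by (auto simp: poly_ring_def nth_poly_X_inv)
qed

lemma poly_ring_add: "f \<in> poly_ring \<Longrightarrow> g \<in> poly_ring \<Longrightarrow> f + g \<in> poly_ring"
  by (simp add: poly_ring_eq)

lemma poly_ring_mult:
  assumes "f \<in> poly_ring" "g \<in> poly_ring"
  shows "f * g \<in> poly_ring"
proof -
  have "f $$ k * g $$ (i - k) = 0" if "i > 0" for i k
    using assms that by (cases "k > 0") (auto simp: poly_ring_eq)
  then have "(f * g) $$ i = 0" if "i > 0" for i
    unfolding fls_times_nth(2) using that by (intro sum.neutral) blast
  then show ?thesis by (simp add: poly_ring_eq)
qed

lemma poly_ring_subdegree:
  assumes "f \<in> poly_ring" "f \<noteq> 0"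
  shows "fls_subdegree f \<le> 0"
  using assms nth_fls_subdegree_nonzero[of f] unfolding poly_ring_eq
  by (metis (mono_tags, lifting) mem_Collect_eq not_le)

lemma poly_ring_0: "0 \<in> poly_ring"
  by (simp add: poly_ring_eq)

lemma poly_ring_1: "1 \<in> poly_ring"
  by (simp add: poly_ring_eq)

lemma poly_ring_uminus: "f \<in> poly_ring \<Longrightarrow> - f \<in> poly_ring"
  by (simp add: poly_ring_eq)

lemmas poly_ring_simps = poly_ring_0 poly_ring_1 poly_ring_uminus

lemma matrix_matrix_mult_2:
  "((g :: 'a::semiring_1 ^ 2 ^ 2) ** h) $ i $ j = g $ i $ 1 * h $ 1 $ j + g $ i $ 2 * h $ 2 $ j"
  by (simp add: matrix_matrix_mult_def sum_2)

lemma poly_GL2_inverse: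
  assumes "g \<in> poly_GL2"
  obtains h where "h \<in> poly_GL2" "g ** h = mat 1" "h ** g = mat 1"
  using assms unfolding poly_GL2_def by blast

lemma poly_GL2_invertible: "g \<in> poly_GL2 \<Longrightarrow> invertible g"
  by (auto simp: poly_GL2_def invertible_def)

lemma poly_GL2_one: "mat 1 \<in> poly_GL2"
proof -
  have "(mat 1 :: 'a fls ^ 2 ^ 2) $ i $ j \<in> poly_ring" for i j
    by (simp add: mat_def poly_ring_simps)
  moreover have "mat 1 ** mat 1 = (mat 1 :: 'a fls ^ 2 ^ 2)" by simp
  ultimately show ?thesis unfolding poly_GL2_def by blast
qed

lemma poly_GL2_mult:
  assumes "g \<in> poly_GL2" "h \<in> poly_GL2"
  shows "g ** h \<in> poly_GL2"
proof -
  obtain g' h' where g': "g' \<in> poly_GL2" "g ** g' = mat 1" "g' ** g = mat 1"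
    and h': "h' \<in> poly_GL2" "h ** h' = mat 1" "h' ** h = mat 1"
    using assms poly_GL2_inverse by metis
  have entries: "\<forall>i j. (a ** b) $ i $ j \<in> poly_ring" if "a \<in> poly_GL2" "b \<in> poly_GL2" for a b :: "'a fls ^ 2 ^ 2"
    using that by (auto simp: poly_GL2_def matrix_matrix_mult_2 intro!: poly_ring_add poly_ring_mult)
  have "(g ** h) ** (h' ** g') = g ** (h ** h') ** g'" "(h' ** g') ** (g ** h) = h' ** (g' ** g) ** h"
    by (simp_all only: matrix_mul_assoc)
  then have "(g ** h) ** (h' ** g') = mat 1" "(h' ** g') ** (g ** h) = mat 1"
    using g' h' by simp_all
  moreover have "\<forall>i j. (g ** h) $ i $ j \<in> poly_ring" "\<forall>i j. (h' ** g') $ i $ j \<in> poly_ring"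
    using entries assms g' h' by blast+
  ultimately show ?thesis
    unfolding poly_GL2_def by blast
qed

definition translation :: "'k::field fls \<Rightarrow> 'k fls ^ 2 ^ 2" where
  "translation p = vec2 (vec2 1 p) (vec2 0 1)"

definition swap :: "'k::field fls ^ 2 ^ 2" where
  "swap = vec2 (vec2 0 1) (vec2 1 0)"

lemma translation_in_poly_GL2:
  assumes "p \<in> poly_ring"
  shows "translation p \<in> poly_GL2"
proof -
  have "translation p ** translation (- p) = mat 1" for p :: "'a fls"
    by (simp add: vec_eq_iff forall_2 matrix_matrix_mult_2 translation_def mat_def)
  from this[of p] this[of "- p"] show ?thesis
    unfolding poly_GL2_def using assms
    by (auto simp: forall_2 translation_def poly_ring_simps intro!: exI[of _ "translation (- p)"])
qed

lemma swap_in_poly_GL2: "swap \<in> poly_GL2"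
proof -
  have "swap ** swap = (mat 1 :: 'a fls ^ 2 ^ 2)"
    by (simp add: vec_eq_iff forall_2 matrix_matrix_mult_2 swap_def mat_def)
  moreover have "\<forall>i j. (swap :: 'a fls ^ 2 ^ 2) $ i $ j \<in> poly_ring"
    by (simp add: forall_2 swap_def poly_ring_simps)
  ultimately show ?thesis
    unfolding poly_GL2_def by blast
qed

lemma act_translation: "act (translation p) (vert n a) = vert n (a + p)"
proof -
  have "(*v) (translation p) ` lat n a \<subseteq> lat n (a + p)" for p a :: "'a fls"
    by (auto simp: lat_def translation_def matrix_vector_mult_2 algebra_simps)
  moreover have "x \<in> (*v) (translation p) ` lat n a" if "x \<in> lat n (a + p)" for x
  proof (rule image_eqI)
    show "x = translation p *v (translation (- p) *v x)"
      by (simp add: vec2_eq_iff translation_def matrix_vector_mult_2)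
    show "translation (- p) *v x \<in> lat n a"
      using that by (simp add: lat_def translation_def matrix_vector_mult_2 algebra_simps)
  qed
  ultimately have "(*v) (translation p) ` lat n a = lat n (a + p)" by blast
  then show ?thesis by (simp add: vert_def act_homothety_class)
qed

lemma act_swap: "act swap (vert n 0) = vert (- n) (0 :: 'k::field fls)"
proof -
  have swap: "swap *v x = vec2 (x $ 2) (x $ 1)" for x :: "'k fls ^ 2"
    by (simp add: vec2_eq_iff swap_def matrix_vector_mult_2)
  have ss: "swap *v (swap *v x) = x" for x :: "'k fls ^ 2"
    by (simp add: vec2_eq_iff swap_def matrix_vector_mult_2)
  have m: "mon n 1 \<noteq> (0 :: 'k fls)" by simp
  have "x \<in> (*v) swap ` lat n 0 \<longleftrightarrow> swap *v x \<in> lat n 0" for x :: "'k fls ^ 2"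
  proof
    assume "swap *v x \<in> lat n 0"
    then have "swap *v (swap *v x) \<in> (*v) swap ` lat n 0" by (rule imageI)
    then show "x \<in> (*v) swap ` lat n 0" by (simp only: ss)
  qed (use ss in auto)
  moreover have "swap *v x \<in> lat n 0 \<longleftrightarrow> x \<in> (*s) (mon n 1) ` lat (- n) 0" for x :: "'k fls ^ 2"
  proof -
    have "x \<in> (*s) (mon n 1) ` lat (- n) 0 \<longleftrightarrow> val_ge 0 (x $ 2 / mon n 1) \<and> val_ge (- n) (x $ 1 / mon n 1)"
      unfolding mem_scale_iff[OF m] by (simp add: lat_def)
    also have "\<dots> \<longleftrightarrow> val_ge n (x $ 2) \<and> val_ge 0 (x $ 1)"
      using val_ge_divide_iff[OF m] by simp
    finally show ?thesis by (auto simp: lat_def swap)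
  qed
  ultimately have "(*v) swap ` lat n 0 = (*s) (mon n 1) ` lat (- n) (0 :: 'k fls)" by blast
  then show ?thesis
    using homothety_class_scale[OF m] by (simp add: vert_def act_homothety_class)
qed

section \<open>Heights\<close>

definition in_orbit :: "'k::field vertex \<Rightarrow> nat \<Rightarrow> bool" where
  "in_orbit v n \<longleftrightarrow> (\<exists>g\<in>poly_GL2. v = act g (ray_vertex n))"

lemma in_orbit_act:
  assumes "in_orbit v n" "g \<in> poly_GL2"
  shows "in_orbit (act g v) n"
  using assms poly_GL2_mult unfolding in_orbit_def by (metis act_mult)

lemma in_orbit_ray: "in_orbit (ray_vertex n) n"
  unfolding in_orbit_def using poly_GL2_one act_one by metis

lemma act_inverse_eq:
  assumes "h ** g = mat 1" "v = act g w"
  shows "w = act h v"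
  using assms by (metis act_mult act_one)

text \<open>
  Suppose that \<open>c g\<close> maps the lattice of \<open>v\<^sub>n\<close> onto that of \<open>v\<^sub>m\<close>, where \<open>n < m\<close>. A nonzero polynomial has
  valuation at most \<open>0\<close>. The bottom row of \<open>g\<close> is nonzero and \<open>c g\<close> maps to vectors with integral second
  coordinate, so \<open>c\<close> has valuation at least \<open>0\<close>. The inverse \<open>c\<^sup>-\<^sup>1 h\<close> maps \<open>(t\<^sup>m, 0)\<close> into the
  lattice spanned by \<open>(t\<^sup>n, 0)\<close> and \<open>(0, 1)\<close>; its image has degree at least \<open>m\<close> in every nonzero
  coordinate, which exceeds both \<open>n\<close> and \<open>0\<close>. So the first column of \<open>h\<close> would vanish.
\<close>

lemma ray_vertices_inequivalent:
  fixes g :: "'k::field fls ^ 2 ^ 2"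
  assumes nm: "n < m" and g: "g \<in> poly_GL2" and eq: "ray_vertex m = act g (ray_vertex n)"
  shows False
proof -
  obtain h where h: "h \<in> poly_GL2" "g ** h = mat 1" "h ** g = mat 1"
    using g poly_GL2_inverse by blast
  have gp: "g $ i $ j \<in> poly_ring" and hp: "h $ i $ j \<in> poly_ring" for i j
    using g h by (auto simp: poly_GL2_def)
  have dets: "det g \<noteq> 0" "det h \<noteq> 0"
    using g h poly_GL2_invertible invertible_det_nz by blast+
  have "homothety_class (lat (- int m) 0) = homothety_class ((*v) g ` lat (- int n) 0)"
    using eq by (simp add: ray_vertex_eq_vert vert_def act_homothety_class)
  then obtain c where c: "c \<noteq> 0" "lat (- int m) 0 = (*s) c ` (*v) g ` lat (- int n) 0"
    by (auto simp: homothety_class_eq_iff)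
  have fwd: "c *s (g *v x) \<in> lat (- int m) 0" if "x \<in> lat (- int n) 0" for x
    using that c by blast
  have bwd: "(1 / c) *s (h *v x) \<in> lat (- int n) 0" if x: "x \<in> lat (- int m) 0" for x
  proof -
    obtain y where y: "y \<in> lat (- int n) 0" "x = c *s (g *v y)" using x c by blast
    then have "(1 / c) *s (h *v x) = (1 / c) *s (c *s (h *v (g *v y)))"
      by (simp only: vector_mult_scale)
    also have "\<dots> = y" using c by (simp add: matrix_vector_mul_assoc h)
    finally show ?thesis using y by simp
  qed
  have cpos: "fls_subdegree c \<ge> 0"
  proof -
    have 1: "val_ge 0 (c * (g $ 2 $ 1 * mon (- int n) 1))"
      using fwd[of "vec2 (mon (- int n) 1) 0"] by (simp add: lat_def val_ge_mon matrix_vector_mult_2)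
    have 2: "val_ge 0 (c * g $ 2 $ 2)"
      using fwd[of "vec2 0 1"] by (simp add: lat_def matrix_vector_mult_2)
    have "g $ 2 $ 1 \<noteq> 0 \<or> g $ 2 $ 2 \<noteq> 0" using dets by (auto simp: det_2)
    then show ?thesis
      using 1 2 c(1) poly_ring_subdegree[OF gp, of 2 1] poly_ring_subdegree[OF gp, of 2 2]
      by (auto simp: val_ge_subdegree)
  qed
  let ?x = "vec2 (mon (- int m) 1) (0 :: 'k fls)"
  have "(1 / c) *s (h *v ?x) \<in> lat (- int n) 0"
    by (rule bwd) (simp add: lat_def val_ge_mon)
  then have "val_ge 0 (h $ 2 $ 1 * mon (- int m) 1 / c)" "val_ge (- int n) (h $ 1 $ 1 * mon (- int m) 1 / c)"
    by (simp_all add: lat_def matrix_vector_mult_2)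
  then have 1: "val_ge (fls_subdegree c) (h $ 2 $ 1 * mon (- int m) 1)"
    and 2: "val_ge (fls_subdegree c - int n) (h $ 1 $ 1 * mon (- int m) 1)"
    using val_ge_divide_iff[OF c(1)] by simp_all
  have h21: "h $ 2 $ 1 = 0"
  proof (rule ccontr)
    assume "h $ 2 $ 1 \<noteq> 0"
    then show False
      using 1 cpos nm poly_ring_subdegree[OF hp, of 2 1] by (simp add: val_ge_subdegree)
  qed
  then have "h $ 1 $ 1 \<noteq> 0" using dets by (auto simp: det_2)
  then show False
    using 2 cpos nm poly_ring_subdegree[OF hp, of 1 1] by (auto simp: val_ge_subdegree)
qed

lemma in_orbit_unique:
  assumes "in_orbit v n" "in_orbit v m"
  shows "n = m"
proof -
  have "\<not> n < m" if nm: "in_orbit v n" "in_orbit v m" for n m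
  proof
    assume "n < m"
    obtain g h where g: "g \<in> poly_GL2" "v = act g (ray_vertex n)" and h: "h \<in> poly_GL2" "v = act h (ray_vertex m)"
      using nm unfolding in_orbit_def by blast
    obtain h' where h': "h' \<in> poly_GL2" "h' ** h = mat 1"
      using h poly_GL2_inverse by metis
    have "ray_vertex m = act (h' ** g) (ray_vertex n)"
      using act_inverse_eq[OF h'(2) h(2)] by (simp only: act_mult flip: g(2))
    then show False
      using ray_vertices_inequivalent[OF \<open>n < m\<close>] poly_GL2_mult h' g by blast
  qed
  then show ?thesis using assms by (meson linorder_neqE_nat)
qed

lemma height_eqI: "in_orbit v n \<Longrightarrow> height v = n"
  unfolding height_def using in_orbit_unique by (intro the_equality) (auto simp: in_orbit_def)

lemma height_ray: "height (ray_vertex n) = n"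
  by (simp add: height_eqI in_orbit_ray)

text \<open>
  The monomial \<open>c\<pi>\<^sup>-\<^sup>n = c t\<^sup>n\<close> is a polynomial, so a translation moves the ball to the centre \<open>0\<close>.
  For \<open>n = 0\<close> the resulting ball \<open>\<pi>\<O>\<close> lies off the ray, on the other side of \<open>v\<^sub>0\<close>.
\<close>

lemma in_orbit_down_neighbour:
  "in_orbit (vert (1 - int n) (mon (- int n) c)) (if n = 0 then 1 else n - 1)"
proof -
  have p: "mon (- int n) c \<in> poly_ring" by (auto simp: poly_ring_eq mon_nth)
  have "in_orbit (vert (1 - int n) (0 :: 'a fls)) (if n = 0 then 1 else n - 1)"
  proof (cases "n = 0")
    case True
    have "vert 1 (0 :: 'a fls) = act swap (ray_vertex 1)"
      by (simp add: ray_vertex_eq_vert act_swap)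
    then have "in_orbit (vert 1 (0 :: 'a fls)) 1"
      by (simp only: in_orbit_act[OF in_orbit_ray swap_in_poly_GL2])
    then show ?thesis using True by simp
  next
    case False
    then have "vert (1 - int n) (0 :: 'a fls) = ray_vertex (n - 1)"
      by (simp add: ray_vertex_eq_vert of_nat_diff)
    then show ?thesis using False in_orbit_ray by simp
  qed
  from in_orbit_act[OF this translation_in_poly_GL2[OF p]] show ?thesis
    by (simp add: act_translation)
qed

lemma ray_neighbours:
  "{w. adjacent (ray_vertex n) w} =
    insert (ray_vertex (n + 1)) (range (\<lambda>c. vert (1 - int n) (mon (- int n) c)))"
proof -
  have "ray_vertex (n + 1) = vert (- int n - 1) 0"
    unfolding ray_vertex_eq_vert by (rule arg_cong2[of _ _ _ _ vert]) simp_all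
  moreover have "adjacent (ray_vertex n) w \<longleftrightarrow>
      w = vert (- int n - 1) 0 \<or> (\<exists>c. w = vert (1 - int n) (mon (- int n) c))" for w :: "'a vertex"
    by (simp add: ray_vertex_eq_vert adjacent_vert_iff)
  ultimately show ?thesis by blast
qed

lemma in_orbit_adjacent:
  assumes "in_orbit v n" "adjacent v w"
  shows "\<exists>m. in_orbit w m"
proof -
  obtain g where g: "g \<in> poly_GL2" "v = act g (ray_vertex n)"
    using assms by (auto simp: in_orbit_def)
  obtain h where h: "h \<in> poly_GL2" "g ** h = mat 1" "h ** g = mat 1"
    using g poly_GL2_inverse by blast
  have "adjacent (ray_vertex n) (act h w)"
    using adjacent_act[OF poly_GL2_invertible[OF h(1)] assms(2)] act_inverse_eq[OF h(3) g(2)] by simp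
  then have "act h w \<in> insert (ray_vertex (n + 1)) (range (\<lambda>c. vert (1 - int n) (mon (- int n) c)))"
    unfolding ray_neighbours [symmetric] by simp
  then obtain m where "in_orbit (act h w) m"
    using in_orbit_ray in_orbit_down_neighbour by fastforce
  then have "in_orbit (act g (act h w)) m"
    using in_orbit_act g(1) by blast
  moreover have "act g (act h w) = w"
    by (simp add: h act_one flip: act_mult)
  ultimately show ?thesis by auto
qed

text \<open>
  A ball around \<open>a\<close> that contains \<open>\<O>\<close> is a ray vertex, and from there the chain of balls around \<open>a\<close>
  leads to the given one through adjacent vertices.
\<close>

lemma in_orbit_vert: "\<exists>k. in_orbit (vert n a) k"
proof -
  \<comment> \<open>The bounds put \<open>\<O>\<close>, \<open>a\<close> and the given ball into the starting ball \<open>\<pi>\<^sup>m\<O>\<close>.\<close>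
  define m where "m = min (min 0 (fls_subdegree a)) n"
  have "val_ge m a" by (rule val_ge_mono[OF val_ge_self]) (simp add: m_def)
  then have "vert m a = ray_vertex (nat (- m))"
    by (simp add: ray_vertex_eq_vert vert_eq_iff m_def)
  then have base: "\<exists>k. in_orbit (vert m a) k" using in_orbit_ray by metis
  have "m \<le> n" by (simp add: m_def)
  then show ?thesis
  proof (induction n rule: int_ge_induct)
    case (step i)
    then show ?case using adjacent_child[of i a 0] in_orbit_adjacent by fastforce
  qed (rule base)
qed

lemma in_orbit_height:
  assumes "adjacent v w"
  shows "in_orbit v (height v)"
  using assms adjacent_imp_vert in_orbit_vert height_eqI by metis

text \<open>
  The element that moves \<open>v\<close> to the ray is a graph automorphism preserving heights, so it suffices
  to look at the neighbours of a ray vertex. For height \<open>0\<close> all neighbours have height \<open>1\<close>, and which of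
  them is called \<open>up\<close> is immaterial.
\<close>

lemma neighbours_by_height:
  fixes v :: "'k::{field,finite} vertex"
  assumes "adjacent v v'"
  obtains up D where "{w. adjacent v w} = insert up D" "up \<notin> D" "finite D" "card D = CARD('k)"
    "height up = height v + 1"
    "\<And>w. w \<in> D \<Longrightarrow> height w = (if height v = 0 then 1 else height v - 1)"
proof -
  define n where "n = height v"
  obtain g where g: "g \<in> poly_GL2" "v = act g (ray_vertex n)"
    using in_orbit_height[OF assms] by (auto simp: in_orbit_def n_def)
  obtain h where h: "h \<in> poly_GL2" "g ** h = mat 1" "h ** g = mat 1"
    using g poly_GL2_inverse by blast
  have inv: "act g (act h w) = w" "act h (act g w) = w" for w
    by (simp_all add: h act_one flip: act_mult)
  have "adjacent v w \<longleftrightarrow> adjacent (ray_vertex n) (act h w)" for w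
    using adjacent_act[OF poly_GL2_invertible] g h inv by metis
  then have nb: "{w. adjacent v w} = act g ` {w. adjacent (ray_vertex n) w}"
  proof (intro equalityI subsetI)
    fix w assume "w \<in> {w. adjacent v w}"
    then have "act h w \<in> {w. adjacent (ray_vertex n) w}"
      using \<open>\<And>w. adjacent v w \<longleftrightarrow> adjacent (ray_vertex n) (act h w)\<close> by simp
    then have "act g (act h w) \<in> act g ` {w. adjacent (ray_vertex n) w}" by (rule imageI)
    then show "w \<in> act g ` {w. adjacent (ray_vertex n) w}" by (simp only: inv)
  qed (use inv \<open>\<And>w. adjacent v w \<longleftrightarrow> adjacent (ray_vertex n) (act h w)\<close> in auto)
  define D where "D = act g ` range (\<lambda>c :: 'k. vert (1 - int n) (mon (- int n) c))"
  have "inj (\<lambda>c :: 'k. vert (1 - int n) (mon (- int n) c))"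
  proof (rule injI)
    fix c d :: 'k
    assume "vert (1 - int n) (mon (- int n) c) = vert (1 - int n) (mon (- int n) d)"
    then have "(mon (- int n) c - mon (- int n) d) $$ (- int n) = 0"
      by (simp add: vert_eq_iff val_ge_def)
    then show "c = d" by (simp add: mon_nth)
  qed
  moreover have injg: "inj (act g)" using inv by (metis injI)
  ultimately have card: "card D = CARD('k)"
    unfolding D_def by (simp add: card_image inj_on_subset)
  show ?thesis
  proof (rule that[of "act g (ray_vertex (n + 1))" D])
    show "{w. adjacent v w} = insert (act g (ray_vertex (n + 1))) D"
      unfolding nb ray_neighbours D_def by simp
    show "act g (ray_vertex (n + 1)) \<notin> D"
      using injg by (auto simp: D_def inj_eq ray_vertex_eq_vert vert_eq_iff)
    show "height (act g (ray_vertex (n + 1))) = height v + 1"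
      using in_orbit_act[OF in_orbit_ray g(1)] height_eqI n_def by blast
    show "height w = (if height v = 0 then 1 else height v - 1)" if "w \<in> D" for w
      using that in_orbit_act[OF in_orbit_down_neighbour g(1)] height_eqI n_def
      unfolding D_def by blast
  qed (use card in \<open>simp_all add: D_def\<close>)
qed


section \<open>Uniqueness of non-backtracking paths\<close>

text \<open>
  The level is the Busemann function of the end \<open>\<infinity>\<close> of the tree, normalised to vanish at \<open>v\<^sub>0\<close>, and the
  parent is the neighbour in the direction of that end. A vertex of height \<open>0\<close> has several neighbours
  of greater height, whereas every vertex has exactly one neighbour of smaller level; this is what
  rules out cycles.
\<close>

definition level :: "'k::field vertex \<Rightarrow> int" where
  "level v = (THE n. \<exists>a. v = vert n a)"

definition parent :: "'k::field vertex \<Rightarrow> 'k vertex" where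
  "parent v = (THE w. \<exists>n a. v = vert n a \<and> w = vert (n - 1) a)"

lemma level_vert: "level (vert n a) = n"
  unfolding level_def by (rule the_equality) (auto simp: vert_eq_iff intro: exI[of _ a])

lemma parent_vert: "parent (vert n a) = vert (n - 1) a"
  unfolding parent_def
proof (rule the_equality)
  fix w assume "\<exists>m b. vert n a = vert m b \<and> w = vert (m - 1) b"
  then obtain m b where "n = m" "val_ge n (a - b)" "w = vert (m - 1) b"
    by (auto simp: vert_eq_iff)
  moreover from this have "vert (n - 1) a = vert (n - 1) b"
    by (intro vert_cong) (simp add: val_ge_mono)
  ultimately show "w = vert (n - 1) a" by simp
qed auto

lemma adjacent_level_cases:
  assumes "adjacent v w"
  shows "w = parent v \<and> level w = level v - 1 \<or> v = parent w \<and> level w = level v + 1"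
proof -
  obtain n a where v: "v = vert n a" using assms adjacent_imp_vert by blast
  from assms consider "w = vert (n - 1) a" | c where "w = vert (n + 1) (a + mon n c)"
    unfolding v adjacent_vert_iff by blast
  then show ?thesis
  proof cases
    case 1
    then show ?thesis by (simp add: v parent_vert level_vert)
  next
    case 2
    moreover have "vert n (a + mon n c) = vert n a"
      by (simp add: vert_eq_iff val_ge_mon)
    ultimately show ?thesis by (simp add: v parent_vert level_vert)
  qed
qed

lemma level_parent: "adjacent v w \<Longrightarrow> level (parent v) = level v - 1"
  using adjacent_imp_vert parent_vert level_vert by metis

definition nb_path :: "nat \<Rightarrow> (nat \<Rightarrow> 'k::field vertex) \<Rightarrow> bool" where
  "nb_path M p \<longleftrightarrow> (\<forall>i<M. adjacent (p i) (p (Suc i))) \<and> (\<forall>i. Suc i < M \<longrightarrow> p (Suc (Suc i)) \<noteq> p i)"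

lemma nb_path_Suc: "nb_path (Suc M) p \<Longrightarrow> nb_path M p"
  by (simp add: nb_path_def)

lemma nb_path_level: "nb_path M p \<Longrightarrow> level (p M) \<ge> level (p 0) - int M"
proof (induction M)
  case (Suc M)
  then have "adjacent (p M) (p (Suc M))" by (simp add: nb_path_def)
  then show ?case using Suc adjacent_level_cases nb_path_Suc by fastforce
qed simp

text \<open>
  Once a path has stepped down to a child, a later step up would return to the vertex it came
  from. So if the last step goes up, all steps do.
\<close>

lemma nb_path_ending_upwards:
  assumes "nb_path (Suc M) p" "p (Suc M) = parent (p M)"
  shows "(\<forall>i\<le>Suc M. p i = (parent ^^ i) (p 0)) \<and> level (p (Suc M)) = level (p 0) - int (Suc M)"
  using assms
proof (induction M)
  case 0
  then show ?case using level_parent[of "p 0" "p 1"] by (auto simp: nb_path_def le_Suc_eq)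
next
  case (Suc M)
  have adj: "adjacent (p M) (p (Suc M))" "adjacent (p (Suc M)) (p (Suc (Suc M)))"
    and ne: "p (Suc (Suc M)) \<noteq> p M"
    using Suc.prems by (auto simp: nb_path_def)
  have "p (Suc M) = parent (p M)"
    using adjacent_level_cases[OF adj(1)] ne Suc.prems by auto
  then have IH: "p i = (parent ^^ i) (p 0)" "level (p (Suc M)) = level (p 0) - int (Suc M)"
    if "i \<le> Suc M" for i
    using Suc.IH[OF nb_path_Suc[OF Suc.prems(1)]] that by blast+
  have "p (Suc (Suc M)) = (parent ^^ Suc (Suc M)) (p 0)"
    using IH(1)[of "Suc M"] Suc.prems(2) by simp
  moreover have "level (p (Suc (Suc M))) = level (p 0) - int (Suc (Suc M))"
    using IH(2)[of 0] Suc.prems(2) level_parent[OF adj(2)] by simp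
  ultimately show ?case
    using IH(1) le_Suc_eq by metis
qed

text \<open>
  Compare the last steps. If both go down, both paths come from the parent of their common end, and
  induction applies. If both go up, both paths consist of iterated parents of their common start.
  They cannot differ, because only a path that always goes up reaches the lowest possible level.
\<close>

lemma nb_path_unique:
  assumes "nb_path M p" "nb_path M q" "p 0 = q 0" "p M = q M" "i \<le> M"
  shows "p i = q i"
  using assms
proof (induction M arbitrary: i)
  case (Suc M)
  have *: False if "nb_path (Suc M) p" "nb_path (Suc M) q" "p 0 = q 0" "p (Suc M) = q (Suc M)"
    "p (Suc M) = parent (p M)" "level (q (Suc M)) = level (q M) + 1" for p q :: "nat \<Rightarrow> 'a vertex"
    using nb_path_ending_upwards[OF that(1,5)] nb_path_level[OF nb_path_Suc[OF that(2)]] that by simp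
  have adj: "adjacent (p M) (p (Suc M))" "adjacent (q M) (q (Suc M))"
    using Suc.prems by (auto simp: nb_path_def)
  consider "p (Suc M) = parent (p M)" "q (Suc M) = parent (q M)"
    | "p M = parent (p (Suc M))" "q M = parent (q (Suc M))"
    using adjacent_level_cases[OF adj(1)] adjacent_level_cases[OF adj(2)]
      *[OF Suc.prems(1-4)] *[OF Suc.prems(2,1) Suc.prems(3,4)[symmetric]] by blast
  then show ?case
  proof cases
    case 1
    have "p i = (parent ^^ i) (p 0)"
      using nb_path_ending_upwards[OF Suc.prems(1) 1(1)] Suc.prems(5) by blast
    moreover have "q i = (parent ^^ i) (q 0)"
      using nb_path_ending_upwards[OF Suc.prems(2) 1(2)] Suc.prems(5) by blast
    ultimately show ?thesis using Suc.prems(3) by simp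
  next
    case 2
    then have "p M = q M" using Suc.prems by simp
    then show ?thesis
      using Suc.IH[OF nb_path_Suc[OF Suc.prems(1)] nb_path_Suc[OF Suc.prems(2)]] Suc.prems(3-5)
      by (metis le_Suc_eq)
  qed
qed simp

section \<open>Counting descendants\<close>

lemma Desc_eq: "Desc N (u, v) = {p (Suc N) | p. p 0 = u \<and> p 1 = v \<and> nb_path (Suc N) p}"
  by (simp add: Desc_def nb_path_def less_Suc_eq_le Suc_le_eq)

lemma Desc_0:
  assumes "adjacent u v"
  shows "Desc 0 (u, v) = {v}"
proof -
  have "\<exists>p. v = p 1 \<and> p 0 = u \<and> p 1 = v \<and> nb_path 1 p"
    using assms by (intro exI[of _ "\<lambda>i. if i = 0 then u else v"]) (simp add: nb_path_def)
  then show ?thesis by (auto simp: Desc_eq)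
qed

lemma Desc_Suc:
  assumes "adjacent u v"
  shows "Desc (Suc N) (u, v) = (\<Union>w\<in>{w. adjacent v w} - {u}. Desc N (v, w))"
proof (intro equalityI subsetI)
  fix z assume "z \<in> Desc (Suc N) (u, v)"
  then obtain p where p: "z = p (Suc (Suc N))" "p 0 = u" "p 1 = v" "nb_path (Suc (Suc N)) p"
    by (auto simp: Desc_eq)
  have "nb_path (Suc N) (\<lambda>i. p (Suc i))"
    using p(4) by (simp add: nb_path_def)
  then have "z \<in> Desc N (v, p 2)"
    using p unfolding Desc_eq by (auto simp: numeral_2_eq_2 intro!: exI[of _ "\<lambda>i. p (Suc i)"])
  moreover have "adjacent v (p 2)" "p 2 \<noteq> u"
    using p unfolding nb_path_def by (force simp: numeral_2_eq_2)+
  ultimately show "z \<in> (\<Union>w\<in>{w. adjacent v w} - {u}. Desc N (v, w))" by blast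
next
  fix z assume "z \<in> (\<Union>w\<in>{w. adjacent v w} - {u}. Desc N (v, w))"
  then obtain w p where w: "w \<noteq> u" and p: "z = p (Suc N)" "p 0 = v" "p 1 = w" "nb_path (Suc N) p"
    by (auto simp: Desc_eq)
  let ?p = "case_nat u p"
  have "nb_path (Suc (Suc N)) ?p"
    using p w assms by (auto simp: nb_path_def less_Suc_eq_0_disj split: nat.split)
  then show "z \<in> Desc (Suc N) (u, v)"
    using p unfolding Desc_eq by (auto intro!: exI[of _ ?p])
qed

lemma Desc_disjoint:
  assumes "w \<noteq> w'"
  shows "Desc N (v, w) \<inter> Desc N (v, w') = {}"
proof (rule equals0I)
  fix z assume "z \<in> Desc N (v, w) \<inter> Desc N (v, w')"
  then obtain p q where p: "z = p (Suc N)" "p 0 = v" "p 1 = w" "nb_path (Suc N) p"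
    and q: "z = q (Suc N)" "q 0 = v" "q 1 = w'" "nb_path (Suc N) q"
    unfolding Desc_eq by blast
  have "p 1 = q 1"
    by (rule nb_path_unique[OF p(4) q(4)]) (use p q in simp_all)
  then show False using p(3) q(3) assms by simp
qed

lemma finite_neighbours: "finite {w :: 'k::{field,finite} vertex. adjacent v w}"
proof (cases "\<exists>w. adjacent v w")
  case True
  then obtain w where "adjacent v w" by blast
  then show ?thesis by (rule neighbours_by_height) simp
qed simp

lemma finite_Desc:
  fixes u v :: "'k::{field,finite} vertex"
  shows "adjacent u v \<Longrightarrow> finite (Desc N (u, v))"
  by (induction N arbitrary: u v) (auto simp: Desc_0 Desc_Suc finite_neighbours)

lemma card_Desc_Suc:
  fixes u v :: "'k::{field,finite} vertex"
  assumes "adjacent u v"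
  shows "card {z \<in> Desc (Suc N) (u, v). height z = j} =
    (\<Sum>w\<in>{w. adjacent v w} - {u}. card {z \<in> Desc N (v, w). height z = j})"
proof -
  have "{z \<in> Desc (Suc N) (u, v). height z = j} =
      (\<Union>w\<in>{w. adjacent v w} - {u}. {z \<in> Desc N (v, w). height z = j})"
    using Desc_Suc[OF assms] by blast
  also have "card \<dots> = (\<Sum>w\<in>{w. adjacent v w} - {u}. card {z \<in> Desc N (v, w). height z = j})"
  proof (rule card_UN_disjoint)
    show "\<forall>w\<in>{w. adjacent v w} - {u}. \<forall>w'\<in>{w. adjacent v w} - {u}. w \<noteq> w' \<longrightarrow>
        {z \<in> Desc N (v, w). height z = j} \<inter> {z \<in> Desc N (v, w'). height z = j} = {}"
      using Desc_disjoint by blast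
  qed (simp_all add: finite_neighbours finite_Desc)
  finally show ?thesis .
qed

text \<open>
  The transition rule of the states as a recursion for the number of descendants of a given height.
  For \<open>k = 0\<close> the forward equation is not the transition rule, but no edge is in that state and the
  recursion does not reach it from any other state.
\<close>

fun state_count :: "nat \<Rightarrow> direction \<Rightarrow> nat \<Rightarrow> nat \<Rightarrow> nat \<Rightarrow> nat" where
  "state_count q \<epsilon> k 0 j = of_bool (j = k)"
| "state_count q Fwd k (Suc N) j =
    state_count q Fwd (k + 1) N j + (q - 1) * state_count q Bwd (k - 1) N j"
| "state_count q Bwd k (Suc N) j =
    q * (if k = 0 then state_count q Fwd 1 N j else state_count q Bwd (k - 1) N j)"

text \<open>
  A forward edge comes from below, so its starting vertex is one of the \<open>q\<close> lower neighbours, which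
  leaves the upper one and \<open>q - 1\<close> lower ones. A backward edge of positive height comes from the upper
  neighbour and leaves the \<open>q\<close> lower ones. At height \<open>0\<close>, any \<open>q\<close> of the \<open>q + 1\<close> neighbours have height \<open>1\<close>.
\<close>

lemma card_Desc_eq_state_count:
  fixes e :: "'k::{field,finite} vertex \<times> 'k vertex"
  assumes "has_state e \<epsilon> k"
  shows "card {z \<in> Desc N e. height z = j} = state_count CARD('k) \<epsilon> k N j"
  using assms
proof (induction N arbitrary: e \<epsilon> k)
  case 0
  obtain u v where e: "e = (u, v)" by (cases e)
  have "adjacent u v" "height v = k" using 0 by (cases \<epsilon>; simp add: e)+
  then have "{z \<in> Desc 0 e. height z = j} = (if j = k then {v} else {})"
    by (auto simp: e Desc_0)
  then show ?case by simp
next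
  case (Suc N)
  obtain u v where e: "e = (u, v)" by (cases e)
  have adj: "adjacent u v" and hv: "height v = k" using Suc.prems by (cases \<epsilon>; simp add: e)+
  obtain up D where nb: "{w. adjacent v w} = insert up D" "up \<notin> D" "finite D" "card D = CARD('k)"
    and hup: "height up = k + 1"
    and hD: "\<And>w. w \<in> D \<Longrightarrow> height w = (if k = 0 then 1 else k - 1)"
    by (rule neighbours_by_height[OF adjacent_sym[OF adj], unfolded hv]) (rule that)
  have u: "u \<in> insert up D" using adjacent_sym[OF adj] nb(1) by blast
  have adjD: "adjacent v w" if "w \<in> insert up D" for w using that nb(1) by blast
  show ?case
  proof (cases \<epsilon>)
    case Fwd
    then have k: "k = height u + 1" using Suc.prems by (simp add: e)
    then have "u \<in> D" using u hup by auto
    then have nbu: "{w. adjacent v w} - {u} = insert up (D - {u})" using nb by blast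
    have "card {z \<in> Desc N (v, up). height z = j} = state_count CARD('k) Fwd (k + 1) N j"
      by (rule Suc.IH) (simp add: adjD hup hv)
    moreover have "card {z \<in> Desc N (v, w). height z = j} = state_count CARD('k) Bwd (k - 1) N j"
      if "w \<in> D" for w
      by (rule Suc.IH) (use that hD k in \<open>simp add: adjD hv\<close>)
    moreover have "card (D - {u}) = CARD('k) - 1" using \<open>u \<in> D\<close> nb by simp
    ultimately show ?thesis
      unfolding e card_Desc_Suc[OF adj] nbu using Fwd nb by simp
  next
    case Bwd
    then have hu: "height u = k + 1" using Suc.prems by (simp add: e)
    let ?W = "{w. adjacent v w} - {u}"
    have "card ?W = CARD('k)" using u nb by simp
    moreover have "card {z \<in> Desc N (v, w). height z = j} =
        (if k = 0 then state_count CARD('k) Fwd 1 N j else state_count CARD('k) Bwd (k - 1) N j)"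
      if w: "w \<in> ?W" for w
    proof (cases "k = 0")
      case True
      then have "height w = 1" using w nb(1) hup hD by auto
      then have "has_state (v, w) Fwd 1" using True w hv by simp
      then show ?thesis using Suc.IH True by simp
    next
      case False
      then have "u \<notin> D" using hD hu by force
      then have "w \<in> D" using w nb(1) u by blast
      then have "has_state (v, w) Bwd (k - 1)" using False w hv hD by simp
      then show ?thesis using Suc.IH False by simp
    qed
    ultimately show ?thesis
      unfolding e card_Desc_Suc[OF adj] using Bwd by simp
  qed
qed

lemma adjacent_ray: "adjacent (ray_vertex n) (ray_vertex (n + 1))"
  using ray_neighbours by blast

text \<open>
  An edge in the given state is needed for the count to be the only common value; the ray provides one
  in every state that occurs.
\<close>

lemma C_count_eq_state_count:
  assumes "has_state (e :: 'k::{field,finite} vertex \<times> 'k vertex) \<epsilon> k"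
  shows "C_count TYPE('k) \<epsilon> k N j = state_count CARD('k) \<epsilon> k N j"
  unfolding C_count_def
  using assms card_Desc_eq_state_count by (intro the_equality) blast+

lemma C_count_Fwd:
  assumes "k \<ge> 1"
  shows "C_count TYPE('k::{field,finite}) Fwd k N j = state_count CARD('k) Fwd k N j"
  by (rule C_count_eq_state_count[of "(ray_vertex (k - 1), ray_vertex k)"])
    (use assms adjacent_ray[of "k - 1"] in \<open>simp add: height_ray\<close>)

lemma C_count_Bwd: "C_count TYPE('k::{field,finite}) Bwd k N j = state_count CARD('k) Bwd k N j"
  by (rule C_count_eq_state_count[of "(ray_vertex (k + 1), ray_vertex k)"])
    (use adjacent_sym[OF adjacent_ray[of k]] in \<open>simp add: height_ray\<close>)

lemma state_count_Fwd_unrolled: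
  "state_count q Fwd k N j =
    of_bool (j = k + N) + (q - 1) * (\<Sum>r<N. state_count q Bwd (k + r - 1) (N - r - 1) j)"
proof (induction N arbitrary: k)
  case (Suc N)
  then show ?case
    by (simp add: sum.lessThan_Suc_shift algebra_simps del: sum.lessThan_Suc)
qed simp

theorem proposition3p8:
  fixes k N :: nat
  assumes "k \<ge> 1"
  shows "(\<forall>j. C_count TYPE('k::{field,finite}) Fwd k N j =
            of_bool (j = k + N) +
            (CARD('k) - 1) * (\<Sum>r<N. C_count TYPE('k) Bwd (k + r - 1) (N - r - 1) j))
       \<and> mu TYPE('k) Fwd k N =
           (\<lambda>j. 1 / real CARD('k) ^ N * dirac (k + N) j +
                (real CARD('k) - 1) *
                  (\<Sum>r<N. 1 / real CARD('k) ^ (r + 1) * mu TYPE('k) Bwd (k + r - 1) (N - r - 1) j))"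
proof (intro conjI allI ext)
  fix j
  let ?q = "real CARD('k)"
  let ?B = "\<lambda>r. C_count TYPE('k) Bwd (k + r - 1) (N - r - 1) j"
  show counts: "C_count TYPE('k) Fwd k N j = of_bool (j = k + N) + (CARD('k) - 1) * (\<Sum>r<N. ?B r)"
    unfolding C_count_Fwd[OF assms] C_count_Bwd by (rule state_count_Fwd_unrolled)
  have q: "?q \<noteq> 0" "real (CARD('k) - 1) = ?q - 1"
    by (simp_all add: of_nat_diff Suc_leI)
  have "1 / ?q ^ (r + 1) * mu TYPE('k) Bwd (k + r - 1) (N - r - 1) j = real (?B r) / ?q ^ N"
    if "r < N" for r
  proof -
    have "?q ^ (r + 1) * ?q ^ (N - r - 1) = ?q ^ N"
      unfolding power_add [symmetric] using that by (intro arg_cong[of _ _ "power ?q"]) simp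
    then show ?thesis by (simp add: mu_def flip: times_divide_times_eq)
  qed
  then have "(\<Sum>r<N. 1 / ?q ^ (r + 1) * mu TYPE('k) Bwd (k + r - 1) (N - r - 1) j) =
      (\<Sum>r<N. real (?B r)) / ?q ^ N"
    by (simp add: sum_divide_distrib)
  moreover have "mu TYPE('k) Fwd k N j =
      (dirac (k + N) j + (?q - 1) * (\<Sum>r<N. real (?B r))) / ?q ^ N"
    unfolding mu_def counts dirac_def by (simp add: q indicator_def)
  ultimately show "mu TYPE('k) Fwd k N j = 1 / ?q ^ N * dirac (k + N) j +
      (?q - 1) * (\<Sum>r<N. 1 / ?q ^ (r + 1) * mu TYPE('k) Bwd (k + r - 1) (N - r - 1) j)"
    by (simp add: add_divide_distrib)
qed

end
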